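(* Let $N$ be the number of classes, let $w_1,\dots,w_N\in\mathbb{R}^d$ be the current class weight vectors of the last layer of the network, let $(x,y)$ be an input with true class $y\in\{1,\dots,N\}$, let $E_x\in\mathbb{R}^d$ be the embedding vector of the input $x$, and let $K,L\ge 1$ be integers (the LSH parameters). For a class $i\neq y$, let $p_i$ be the probability that class $i$ is sampled as a negative sample by the LSH Embedding method, i.e. that $i$ is retrieved when the $(K,L)$-parametrized LSH hash tables storing $w_1,\dots,w_N$ are queried with the vector $E_x$. Then $$p_i \;\propto\; 1-\bigl(1-p_{E_x w_i}^{K}\bigr)^{L},$$ where $p_{E_x w_i}$ is the collision probability of the LSH hash values of $E_x$ and $w_i$. Furthermore, for classes $i,j\neq y$, the probability of sampling class $i$ is more than that of sampling any other class $j$ if and only if $sim(E_x,w_i)>sim(E_x,w_j)$, where $sim$ is the underlying similarity function of the LSH.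
   Context: LSH family: a family $\mathcal{H}$ of hash functions on $\mathbb{R}^d$ with a probability distribution on it, together with a similarity function $sim:\mathbb{R}^d\times\mathbb{R}^d\to\mathbb{R}$, such that the collision probability $p_{uv}:=\Pr_{h\sim\mathcal{H}}(h(u)=h(v))$ satisfies $p_{uv}=f(sim(u,v))$ for all $u,v$, where $f$ is a monotonically increasing function. $(K,L)$-parametrized hash tables: draw $K\times L$ independent hash functions $h_{k,t}$ ($1\le k\le K$, $1\le t\le L$) from $\mathcal{H}$. For each table $t=1,\dots,L$ define the meta-hash $H_t(v)=(h_{1,t}(v),\dots,h_{K,t}(v))$. Preprocessing: for every class $i\in\{1,\dots,N\}$ and every $t$, store the index $i$ in the bucket of table $t$ given by $H_t(w_i)$. Querying with a vector $q\in\mathbb{R}^d$: for each $t$, look up the bucket of table $t$ given by $H_t(q)$; the set of retrieved samples is the union over $t=1,\dots,L$ of the contents of these buckets. Embedding: $E_x\in\mathbb{R}^d$ is the vector of activations in the penultimate layer of the neural network when fed with the input $x$. LSH Embedding method: for the input $(x,y)$, query with $q=E_x$; the retrieved classes other than $y$ are the negative samples. Probabilities are over the random choice of hash functions, with the input and the current network parameters (hence $E_x$ and all $w_i$) held fixed. *)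

theory Defs
  imports "HOL-Probability.Probability"
begin

text \<open>A distribution over hash functions is a measure on the function type itself, the hash
  values living in an arbitrary type \<open>'h\<close>.\<close>

type_synonym ('d, 'h) hash_fun = "real ^ 'd \<Rightarrow> 'h"

definition collision_prob ::
    "('d::finite, 'h) hash_fun measure \<Rightarrow> real ^ 'd \<Rightarrow> real ^ 'd \<Rightarrow> real" where
  "collision_prob \<H> u v = measure \<H> {h \<in> space \<H>. h u = h v}"

text \<open>The collision events are required to be measurable, since otherwise the collision
  probability is not defined. ``Monotonically increasing'' means strictly increasing: for a
  merely nondecreasing \<open>f\<close>, pairs of different similarity could have the same collision
  probability. The function \<open>f\<close> is constrained only on the values attained by \<open>sim\<close>, as
  similarities such as the cosine have a bounded range.\<close>

locale lsh_family = prob_space \<H>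
  for \<H> :: "('d::finite, 'h) hash_fun measure" +
  fixes sim :: "real ^ 'd \<Rightarrow> real ^ 'd \<Rightarrow> real"
    and f :: "real \<Rightarrow> real"
  assumes collision_sets: "{h \<in> space \<H>. h u = h v} \<in> sets \<H>"
    and f_increasing: "strict_mono_on {sim u v |u v. True} f"
    and collision_prob_eq: "collision_prob \<H> u v = f (sim u v)"

text \<open>A draw of the hash functions is a family \<open>g\<close>, where \<open>g (k, t)\<close> is the \<open>k\<close>-th hash
  function of table \<open>t\<close>. Independent draws correspond to the product measure.\<close>

definition hash_draws ::
    "('d::finite, 'h) hash_fun measure \<Rightarrow> nat \<Rightarrow> nat \<Rightarrow> (nat \<times> nat \<Rightarrow> ('d, 'h) hash_fun) measure" where
  "hash_draws \<H> K L = PiM ({1..K} \<times> {1..L}) (\<lambda>_. \<H>)"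

definition meta_hash ::
    "nat \<Rightarrow> (nat \<times> nat \<Rightarrow> ('d::finite, 'h) hash_fun) \<Rightarrow> nat \<Rightarrow> real ^ 'd \<Rightarrow> 'h list" where
  "meta_hash K g t v = map (\<lambda>k. g (k, t) v) [1..<Suc K]"

definition bucket ::
    "nat \<Rightarrow> nat \<Rightarrow> (nat \<Rightarrow> real ^ 'd) \<Rightarrow> (nat \<times> nat \<Rightarrow> ('d::finite, 'h) hash_fun) \<Rightarrow> nat \<Rightarrow> 'h list
      \<Rightarrow> nat set" where
  "bucket K N w g t b = {i \<in> {1..N}. meta_hash K g t (w i) = b}"

definition retrieved ::
    "nat \<Rightarrow> nat \<Rightarrow> nat \<Rightarrow> (nat \<Rightarrow> real ^ 'd) \<Rightarrow> (nat \<times> nat \<Rightarrow> ('d::finite, 'h) hash_fun) \<Rightarrow> real ^ 'd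
      \<Rightarrow> nat set" where
  "retrieved K L N w g q = (\<Union>t\<in>{1..L}. bucket K N w g t (meta_hash K g t q))"

text \<open>LSH Embedding: \<open>E\<close> maps an input to its vector of penultimate-layer activations.\<close>

definition negative_samples ::
    "nat \<Rightarrow> nat \<Rightarrow> nat \<Rightarrow> (nat \<Rightarrow> real ^ 'd) \<Rightarrow> ('x \<Rightarrow> real ^ 'd) \<Rightarrow> 'x \<Rightarrow> nat
      \<Rightarrow> (nat \<times> nat \<Rightarrow> ('d::finite, 'h) hash_fun) \<Rightarrow> nat set" where
  "negative_samples K L N w E x y g = retrieved K L N w g (E x) - {y}"

definition sampling_prob ::
    "('d::finite, 'h) hash_fun measure \<Rightarrow> nat \<Rightarrow> nat \<Rightarrow> nat \<Rightarrow> (nat \<Rightarrow> real ^ 'd)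
      \<Rightarrow> ('x \<Rightarrow> real ^ 'd) \<Rightarrow> 'x \<Rightarrow> nat \<Rightarrow> nat \<Rightarrow> real" where
  "sampling_prob \<H> K L N w E x y i =
     measure (hash_draws \<H> K L)
       {g \<in> space (hash_draws \<H> K L). i \<in> negative_samples K L N w E x y g}"

text \<open>\<open>p \<propto> r\<close> on \<open>I\<close>: the positive constant does not depend on the index.\<close>

definition proportional_on :: "'i set \<Rightarrow> ('i \<Rightarrow> real) \<Rightarrow> ('i \<Rightarrow> real) \<Rightarrow> bool" where
  "proportional_on I p r \<longleftrightarrow> (\<exists>c>0. \<forall>i\<in>I. p i = c * r i)"

end

theory Submission
  imports Defs
begin

text \<open>A class \<open>i\<close> other than \<open>y\<close> is a negative sample iff in some
  table all \<open>K\<close> hashes of its weight vector agree with those of the query. Each hash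
  agrees with probability p, independently, so a table hits with probability p^K. Tables use
  disjoint sets of hashes, so all \<open>L\<close> miss with probability (1 - p^K)^L; the complement
  gives \<open>sampling_prob_eq\<close>, an equality and thus proportionality with constant 1. This
  expression is strictly increasing in p on [0,1] (\<open>retrieval_prob_less_iff\<close>), and p is
  a strictly increasing function of the similarity, which gives the comparison of classes. The
  probabilistic core is \<open>prob_PiM_exists_forall\<close>, which rests on the independence of
  the coordinates of a product measure, proved by identifying their joint law with the product of
  their marginals.\<close>

lemma (in prob_space) indep_vars_PiM_components:
  assumes "I \<noteq> {}"
  shows "prob_space.indep_vars (PiM I (\<lambda>_. M)) (\<lambda>_. M) (\<lambda>i g. g i) I"
proof -
  interpret P: prob_space "PiM I (\<lambda>_. M)"
    by (intro prob_space_PiM prob_space_axioms)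
  have "distr (PiM I (\<lambda>_. M)) M (\<lambda>g. g i) = M" if "i \<in> I" for i
    using distr_PiM_component[of I "\<lambda>_. M" i] that prob_space_axioms by simp
  then have "(\<Pi>\<^sub>M i\<in>I. distr (PiM I (\<lambda>_. M)) M (\<lambda>g. g i)) = PiM I (\<lambda>_. M)"
    by (intro PiM_cong) auto
  \<comment> \<open>Points of the product space are extensional, so restricting them to
    \<open>I\<close> changes nothing: the joint law is the product measure itself.\<close>
  moreover have "distr (PiM I (\<lambda>_. M)) (PiM I (\<lambda>_. M)) (\<lambda>g. \<lambda>i\<in>I. g i)
      = distr (PiM I (\<lambda>_. M)) (PiM I (\<lambda>_. M)) (\<lambda>g. g)"
    by (intro distr_cong) (auto simp: space_PiM)
  ultimately show ?thesis
    using assms by (subst P.indep_vars_iff_distr_eq_PiM') auto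
qed

text \<open>The hashing-free form of the retrieval probability: \<open>J\<close> indexes tables,
  \<open>I\<close> the hashes within a table, and \<open>A\<close> is the collision event.\<close>

lemma (in prob_space) prob_PiM_exists_forall:
  assumes I: "finite I" "I \<noteq> {}" and J: "finite J" "J \<noteq> {}" and A: "A \<in> events"
  shows "measure (PiM (I \<times> J) (\<lambda>_. M))
           {g \<in> space (PiM (I \<times> J) (\<lambda>_. M)). \<exists>j\<in>J. \<forall>i\<in>I. g (i, j) \<in> A}
         = 1 - (1 - prob A ^ card I) ^ card J"
proof -
  let ?P = "PiM (I \<times> J) (\<lambda>_. M)"
  interpret P: prob_space ?P
    by (intro prob_space_PiM prob_space_axioms)
  interpret PP: product_prob_space "\<lambda>_. M" "I \<times> J"
    by unfold_locales
  \<comment> \<open>The event \<open>S j\<close> that table \<open>j\<close> hits depends only on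
    the block \<open>R j\<close> of coordinates; \<open>H j\<close> is the same event within the
    space of that block. This lets independence of the blocks pass to the events.\<close>
  define R where "R j g = restrict g (I \<times> {j})" for j and g :: "'b \<times> 'c \<Rightarrow> 'a"
  define H where "H j = {r \<in> space (PiM (I \<times> {j}) (\<lambda>_. M)). \<forall>i\<in>I. r (i, j) \<in> A}" for j :: 'c
  define S where "S j = {g \<in> space ?P. \<forall>i\<in>I. g (i, j) \<in> A}" for j
  have H: "H j \<in> sets (PiM (I \<times> {j}) (\<lambda>_. M))" for j
    unfolding H_def using I A by measurable
  have S: "S j \<in> P.events" if "j \<in> J" for j
    unfolding S_def using I A by measurable (use that in auto)
  have prob_S: "P.prob (S j) = prob A ^ card I" if "j \<in> J" for j
  proof -
    \<comment> \<open>\<open>S j\<close> is a cylinder over a finite box, so its measure is a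
      product of \<open>card I\<close> equal factors.\<close>
    have "S j = prod_emb (I \<times> J) (\<lambda>_. M) (I \<times> {j}) (\<Pi>\<^sub>E p\<in>I \<times> {j}. A)"
      using that by (auto simp: S_def prod_emb_def space_PiM PiE_def Pi_iff)
    then have "P.prob (S j) = (\<Prod>p\<in>I \<times> {j}. prob A)"
      using that I A by (simp only:) (intro PP.measure_PiM_emb; auto)
    then show ?thesis
      by (simp add: card_cartesian_product)
  qed
  have miss: "R j -` (space (PiM (I \<times> {j}) (\<lambda>_. M)) - H j) \<inter> space ?P = space ?P - S j"
    if "j \<in> J" for j
    using that by (auto simp: R_def H_def S_def space_PiM PiE_iff)
  \<comment> \<open>Restrictions of independent coordinates to pairwise disjoint index blocks are
    independent.\<close>
  have "P.indep_vars (\<lambda>j. PiM (I \<times> {j}) (\<lambda>_. M)) R J"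
    unfolding R_def using I J
    by (intro P.indep_vars_restrict[OF indep_vars_PiM_components])
       (auto simp: disjoint_family_on_def)
  then have "P.prob (\<Inter>j\<in>J. space ?P - S j) = (\<Prod>j\<in>J. P.prob (space ?P - S j))"
    using P.indep_varsD_finite[of "\<lambda>j. PiM (I \<times> {j}) (\<lambda>_. M)" R J
        "\<lambda>j. space (PiM (I \<times> {j}) (\<lambda>_. M)) - H j"] J H miss
    by simp
  also have "\<dots> = (1 - prob A ^ card I) ^ card J"
    using S prob_S by (simp add: P.prob_compl)
  finally have all_miss:
    "P.prob (\<Inter>j\<in>J. space ?P - S j) = (1 - prob A ^ card I) ^ card J" .
  have "{g \<in> space ?P. \<exists>j\<in>J. \<forall>i\<in>I. g (i, j) \<in> A} = space ?P - (\<Inter>j\<in>J. space ?P - S j)"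
    by (auto simp: S_def)
  moreover have "(\<Inter>j\<in>J. space ?P - S j) \<in> P.events"
    using J S by (intro sets.finite_INT) auto
  ultimately show ?thesis
    by (simp only: P.prob_compl all_miss)
qed

lemma meta_hash_eq_iff:
  "meta_hash K g t u = meta_hash K g t v \<longleftrightarrow> (\<forall>k\<in>{1..K}. g (k, t) u = g (k, t) v)"
  by (auto simp: meta_hash_def)

lemma mem_negative_samples_iff:
  assumes "i \<in> {1..N} - {y}"
  shows "i \<in> negative_samples K L N w E x y g
    \<longleftrightarrow> (\<exists>t\<in>{1..L}. \<forall>k\<in>{1..K}. g (k, t) (E x) = g (k, t) (w i))"
  using assms
  by (simp add: negative_samples_def retrieved_def bucket_def meta_hash_eq_iff
      eq_commute[of "g p (E x)" for p])

lemma (in lsh_family) sampling_prob_eq: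
  assumes "K \<ge> 1" "L \<ge> 1" "i \<in> {1..N} - {y}"
  shows "sampling_prob \<H> K L N w E x y i
    = 1 - (1 - collision_prob \<H> (E x) (w i) ^ K) ^ L"
proof -
  let ?A = "{h \<in> space \<H>. h (E x) = h (w i)}"
  have "{g \<in> space (hash_draws \<H> K L). i \<in> negative_samples K L N w E x y g}
      = {g \<in> space (hash_draws \<H> K L). \<exists>t\<in>{1..L}. \<forall>k\<in>{1..K}. g (k, t) \<in> ?A}"
    \<comment> \<open>Every component of a draw lies in the space of \<open>\<H>\<close>, so
      agreement of two hash values is the same as membership in \<open>?A\<close>.\<close>
    unfolding mem_negative_samples_iff[OF assms(3)]
    by (force simp: hash_draws_def space_PiM PiE_iff)
  then show ?thesis
    using prob_PiM_exists_forall[of "{1..K}" "{1..L}" ?A] assms collision_sets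
    by (simp add: sampling_prob_def hash_draws_def collision_prob_def)
qed

text \<open>The two complements each reverse the order and so cancel; positive powers preserve
  strict order on nonnegative reals, and \<open>1 - p ^ K\<close> is nonnegative because p is at
  most 1.\<close>

lemma retrieval_prob_less_iff:
  fixes p q :: real
  assumes "K \<ge> 1" "L \<ge> 1" "p \<in> {0..1}" "q \<in> {0..1}"
  shows "1 - (1 - p ^ K) ^ L < 1 - (1 - q ^ K) ^ L \<longleftrightarrow> p < q"
proof -
  have "1 - (1 - p ^ K) ^ L < 1 - (1 - q ^ K) ^ L \<longleftrightarrow> (1 - q ^ K) ^ L < (1 - p ^ K) ^ L"
    by auto
  also have "\<dots> \<longleftrightarrow> 1 - q ^ K < 1 - p ^ K"
    using assms by (simp add: power_le_one flip: not_le)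
  also have "\<dots> \<longleftrightarrow> p < q"
    using assms by (simp flip: not_le)
  finally show ?thesis .
qed

theorem theorem2:
  fixes \<H> :: "('d::finite, 'h) hash_fun measure"
    and sim :: "real ^ 'd \<Rightarrow> real ^ 'd \<Rightarrow> real"
    and f :: "real \<Rightarrow> real"
    and w :: "nat \<Rightarrow> real ^ 'd"
    and E :: "'x \<Rightarrow> real ^ 'd"
    and x :: 'x
    and y N K L :: nat
  assumes "lsh_family \<H> sim f"
    and "K \<ge> 1" and "L \<ge> 1"
    and "y \<in> {1..N}"
  shows "proportional_on ({1..N} - {y})
           (\<lambda>i. sampling_prob \<H> K L N w E x y i)
           (\<lambda>i. 1 - (1 - collision_prob \<H> (E x) (w i) ^ K) ^ L)
       \<and> (\<forall>i\<in>{1..N} - {y}. \<forall>j\<in>{1..N} - {y}.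
           sampling_prob \<H> K L N w E x y i > sampling_prob \<H> K L N w E x y j
             \<longleftrightarrow> sim (E x) (w i) > sim (E x) (w j))"
proof -
  interpret lsh_family \<H> sim f by fact
  have eq: "sampling_prob \<H> K L N w E x y i
      = 1 - (1 - collision_prob \<H> (E x) (w i) ^ K) ^ L" if "i \<in> {1..N} - {y}" for i
    by (rule sampling_prob_eq) (use assms that in auto)
  have "collision_prob \<H> u v \<in> {0..1}" for u v
    by (simp add: collision_prob_def)
  note less_iff = retrieval_prob_less_iff[OF \<open>K \<ge> 1\<close> \<open>L \<ge> 1\<close> this this]
  have "sampling_prob \<H> K L N w E x y i > sampling_prob \<H> K L N w E x y j
      \<longleftrightarrow> f (sim (E x) (w i)) > f (sim (E x) (w j))"
    if "i \<in> {1..N} - {y}" "j \<in> {1..N} - {y}" for i j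
    by (simp only: eq[OF that(1)] eq[OF that(2)] less_iff) (simp only: collision_prob_eq)
  \<comment> \<open>Strict monotonicity on a linear order also reflects the order; both arguments
    are attained values of \<open>sim\<close>, where \<open>f\<close> is known to increase.\<close>
  moreover have "f (sim u v) > f (sim u v') \<longleftrightarrow> sim u v > sim u v'" for u v v'
    by (intro strict_mono_on_less[OF f_increasing]) auto
  ultimately show ?thesis
    unfolding proportional_on_def by (intro conjI exI[of _ 1] ballI) (simp_all only: eq, simp_all)
qed

end
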